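(* Every typed $\lambda\mu$-term is strongly normalizable; that is, if $\Gamma \vdash M : A$ is derivable for some typing context $\Gamma$, some $\lambda\mu$-term $M$ and some type $A$, then there is no infinite sequence of reductions $M \rightarrow M_1 \rightarrow M_2 \rightarrow \cdots$ starting from $M$.
   Context: Terms. The $\lambda\mu$-terms are given by the grammar $\mathcal{T} ::= x \mid \lambda x\,\mathcal{T} \mid (\mathcal{T}\ \mathcal{T}) \mid \mu x\,\mathcal{T}$, where $x,y,\dots$ range over a single infinite set of variables. Both $\lambda x$ and $\mu x$ bind $x$. Terms are taken up to renaming of bound variables, and $M[x:=N]$ denotes capture-avoiding substitution. Types. Types are the formulas built from propositional atoms and the constant $\bot$ using the connective $\rightarrow$; $\neg A$ abbreviates $A \rightarrow \bot$. Typing. A typing context is a finite set of declarations $x : A$ with distinct variables; $\Gamma_1,\Gamma_2$ denotes the union of (compatible) contexts. The judgement $\Gamma \vdash M : A$ is generated by the rules: (ax) $\Gamma, x : A \vdash x : A$; ($\rightarrow_i$) from $\Gamma, x : A \vdash M : B$ infer $\Gamma \vdash \lambda x M : A \rightarrow B$; ($\rightarrow_e$) from $\Gamma_1 \vdash M : A \rightarrow B$ and $\Gamma_2 \vdash N : A$ infer $\Gamma_1,\Gamma_2 \vdash (M\ N) : B$; ($\bot_c$) from $\Gamma, x : \neg A \vdash M : \bot$ infer $\Gamma \vdash \mu x M : A$. A term is typed if such a judgement is derivable for it. Reduction. $M \rightarrow M'$ means that $M'$ is obtained from $M$ by one application, to any subterm, of one of the rules $(\lambda x M\ N) \rightarrow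 M[x:=N]$ and $(\mu x M\ N) \rightarrow \mu y\, M[x := \lambda z\,(y\ (z\ N))]$, where $y,z$ are fresh variables. *)

theory Defs
  imports Main
begin

text \<open>
  Terms modulo renaming of bound variables are represented with de Bruijn indices. There is one
  sort of variables, so \<open>Lam\<close> and \<open>Mu\<close> both bind index 0 of their body and share
  one index space; free variables are the indices that exceed the number of enclosing binders.
\<close>

datatype trm = Var nat | Lam trm | App trm trm | Mu trm

datatype 'a ty = Atom 'a | Bot | Arrow "'a ty" "'a ty" (infixr "\<rightarrow>\<^sub>t" 60)

abbreviation Neg :: "'a ty \<Rightarrow> 'a ty" where
  "Neg A \<equiv> A \<rightarrow>\<^sub>t Bot"

primrec rename :: "(nat \<Rightarrow> nat) \<Rightarrow> trm \<Rightarrow> trm" where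
  "rename r (Var i) = Var (r i)"
| "rename r (Lam M) = Lam (rename (case_nat 0 (\<lambda>i. Suc (r i))) M)"
| "rename r (App M N) = App (rename r M) (rename r N)"
| "rename r (Mu M) = Mu (rename (case_nat 0 (\<lambda>i. Suc (r i))) M)"

abbreviation shift :: "trm \<Rightarrow> trm" where
  "shift \<equiv> rename Suc"

text \<open>Capture-avoiding simultaneous substitution of \<open>s i\<close> for every free index \<open>i\<close>.\<close>

primrec subst :: "(nat \<Rightarrow> trm) \<Rightarrow> trm \<Rightarrow> trm" where
  "subst s (Var i) = s i"
| "subst s (Lam M) = Lam (subst (case_nat (Var 0) (\<lambda>i. shift (s i))) M)"
| "subst s (App M N) = App (subst s M) (subst s N)"
| "subst s (Mu M) = Mu (subst (case_nat (Var 0) (\<lambda>i. shift (s i))) M)"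

text \<open>
  In \<open>beta\<close> the binder disappears, so the remaining free indices of the body drop by one.
  In \<open>mu\<close> the binder of \<open>x\<close> is replaced by that of \<open>y\<close>, so all other indices
  stay fixed. In the substituted term \<open>\<lambda>z (y (z N))\<close> the index of \<open>z\<close> is 0, that of
  \<open>y\<close> is 1, and \<open>N\<close> has moved under the two binders \<open>y\<close> and \<open>z\<close>.
\<close>

inductive red :: "trm \<Rightarrow> trm \<Rightarrow> bool" (infix "\<rightarrow>\<^sub>r" 50) where
  beta: "App (Lam M) N \<rightarrow>\<^sub>r subst (case_nat N Var) M"
| mu: "App (Mu M) N \<rightarrow>\<^sub>r
    Mu (subst (Var(0 := Lam (App (Var 1) (App (Var 0) (shift (shift N)))))) M)"
| Lam: "M \<rightarrow>\<^sub>r M' \<Longrightarrow> Lam M \<rightarrow>\<^sub>r Lam M'"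
| Mu: "M \<rightarrow>\<^sub>r M' \<Longrightarrow> Mu M \<rightarrow>\<^sub>r Mu M'"
| AppL: "M \<rightarrow>\<^sub>r M' \<Longrightarrow> App M N \<rightarrow>\<^sub>r App M' N"
| AppR: "N \<rightarrow>\<^sub>r N' \<Longrightarrow> App M N \<rightarrow>\<^sub>r App M N'"

definition strongly_normalizable :: "trm \<Rightarrow> bool" where
  "strongly_normalizable M \<longleftrightarrow>
    \<not> (\<exists>S :: nat \<Rightarrow> trm. S 0 = M \<and> (\<forall>n. S n \<rightarrow>\<^sub>r S (Suc n)))"

text \<open>
  A context is a partial map from free indices to types. Its domain need not be an initial
  segment. Finiteness is imposed in rule \<open>ax\<close> and preserved by the other rules, so every
  derivable judgement has a finite context. Under a binder, \<open>case_nat (Some A) G\<close> declares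
  the bound variable 0 with type \<open>A\<close> and moves the declarations of \<open>G\<close> up by one.
\<close>

type_synonym 'a ctx = "nat \<rightharpoonup> 'a ty"

definition compatible :: "'a ctx \<Rightarrow> 'a ctx \<Rightarrow> bool" where
  "compatible G1 G2 \<longleftrightarrow> (\<forall>x \<in> dom G1 \<inter> dom G2. G1 x = G2 x)"

inductive typing :: "'a ctx \<Rightarrow> trm \<Rightarrow> 'a ty \<Rightarrow> bool" ("_ \<turnstile> _ : _" [51, 51, 51] 50) where
  ax: "finite (dom G) \<Longrightarrow> G x = Some A \<Longrightarrow> G \<turnstile> Var x : A"
| arrow_i: "case_nat (Some A) G \<turnstile> M : B \<Longrightarrow> G \<turnstile> Lam M : A \<rightarrow>\<^sub>t B"
| arrow_e: "G1 \<turnstile> M : A \<rightarrow>\<^sub>t B \<Longrightarrow> G2 \<turnstile> N : A \<Longrightarrow> compatible G1 G2 \<Longrightarrow>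
    G1 ++ G2 \<turnstile> App M N : B"
| bot_c: "case_nat (Some (Neg A)) G \<turnstile> M : Bot \<Longrightarrow> G \<turnstile> Mu M : A"

end

theory Submission
  imports Defs
begin

text \<open>
  A type \<open>A\<^sub>1 \<rightarrow> \<dots> \<rightarrow> A\<^sub>k \<rightarrow> P\<close> with \<open>P\<close> atomic or \<open>\<bottom>\<close> is interpreted by stacks
  \<open>N\<^sub>1 \<dots> N\<^sub>k\<close> of reducible terms, and a term is reducible if it is strongly normalizing on every
  such stack. Applied to a stack, \<open>\<mu>x M\<close> consumes the arguments one by one and ends as
  \<open>\<mu>x M[x := K]\<close>, where \<open>K = \<lambda>z (K' (z N\<^sub>1))\<close> and \<open>K'\<close> is built in the same way from
  \<open>N\<^sub>2 \<dots> N\<^sub>k\<close>, starting from a variable for the empty stack. The term \<open>K\<close> is reducible of type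
  \<open>\<not>A\<close>, and \<open>M[x := K]\<close> does not change when an argument is consumed. Hence its strong
  normalization, combined with the length of the stack, bounds the reductions of
  \<open>(\<mu>x M) N\<^sub>1 \<dots> N\<^sub>k\<close>.
\<close>

section \<open>Substitution\<close>

abbreviation up :: "(nat \<Rightarrow> trm) \<Rightarrow> nat \<Rightarrow> trm" where
  "up s \<equiv> case_nat (Var 0) (\<lambda>i. shift (s i))"

lemma rename_rename: "rename r (rename q M) = rename (r \<circ> q) M"
proof (induction M arbitrary: r q)
  case (Lam M)
  have "case_nat 0 (\<lambda>i. Suc (r i)) \<circ> case_nat 0 (\<lambda>i. Suc (q i)) = case_nat 0 (\<lambda>i. Suc ((r \<circ> q) i))"
    by (auto split: nat.split)
  then show ?case by (simp add: Lam)
next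
  case (Mu M)
  have "case_nat 0 (\<lambda>i. Suc (r i)) \<circ> case_nat 0 (\<lambda>i. Suc (q i)) = case_nat 0 (\<lambda>i. Suc ((r \<circ> q) i))"
    by (auto split: nat.split)
  then show ?case by (simp add: Mu)
qed auto

lemma subst_rename: "subst s (rename q M) = subst (s \<circ> q) M"
proof (induction M arbitrary: s q)
  case (Lam M)
  have "up s \<circ> case_nat 0 (\<lambda>i. Suc (q i)) = up (s \<circ> q)"
    by (auto split: nat.split)
  then show ?case by (simp add: Lam)
next
  case (Mu M)
  have "up s \<circ> case_nat 0 (\<lambda>i. Suc (q i)) = up (s \<circ> q)"
    by (auto split: nat.split)
  then show ?case by (simp add: Mu)
qed auto

lemma rename_up:
  "rename (case_nat 0 (\<lambda>i. Suc (r i))) \<circ> up s = up (rename r \<circ> s)"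
  by (auto simp: rename_rename comp_def split: nat.split)

lemma rename_subst: "rename r (subst s M) = subst (rename r \<circ> s) M"
proof (induction M arbitrary: r s)
  case (Lam M)
  then show ?case using rename_up[of r s] by (simp add: comp_def)
next
  case (Mu M)
  then show ?case using rename_up[of r s] by (simp add: comp_def)
qed auto

text \<open>Under a binder the values of \<open>t\<close> are shifted, so \<open>up s\<close> has to
  be moved past a shift; the two mixed laws \<open>subst_rename\<close> and
  \<open>rename_subst\<close> do this.\<close>

lemma subst_up: "subst (up s) \<circ> up t = up (subst s \<circ> t)"
  by (auto simp: subst_rename rename_subst comp_def split: nat.split)

lemma subst_subst: "subst s (subst t M) = subst (subst s \<circ> t) M"
proof (induction M arbitrary: s t)
  case (Lam M)
  then show ?case using subst_up[of s t] by (simp add: comp_def)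
next
  case (Mu M)
  then show ?case using subst_up[of s t] by (simp add: comp_def)
qed auto

lemma up_Var: "case_nat (Var 0) (\<lambda>i. Var (Suc i)) = Var"
  by (auto split: nat.split)

lemma subst_Var: "subst Var M = M"
  by (induction M) (simp_all add: up_Var)

lemma rename_eq_subst: "rename r M = subst (Var \<circ> r) M"
  using rename_subst[of r Var M] by (simp add: subst_Var comp_def)

text \<open>Instantiating index 0 undoes the shifts made by \<open>up s\<close>, so instantiating a
  substituted body amounts to one simultaneous substitution.\<close>

lemma subst_inst_up: "subst (case_nat K Var) (subst (up s) M) = subst (case_nat K s) M"
proof -
  have "subst (case_nat K Var) \<circ> up s = case_nat K s"
    by (auto simp: subst_rename comp_def subst_Var split: nat.split)
  then show ?thesis by (simp add: subst_subst)
qed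

section \<open>Reduction and substitution\<close>

lemma red_subst: "M \<rightarrow>\<^sub>r M' \<Longrightarrow> subst s M \<rightarrow>\<^sub>r subst s M'"
proof (induction arbitrary: s rule: red.induct)
  case (beta M N)
  have "subst s \<circ> case_nat N Var = case_nat (subst s N) s"
    by (auto split: nat.split)
  then show ?case
    using red.beta[of "subst (up s) M" "subst s N"] unfolding subst_inst_up by (simp add: subst_subst)
next
  case (mu M N)
  let ?K = "\<lambda>N. Lam (App (Var 1) (App (Var 0) (shift (shift N))))"
  \<comment> \<open>At index 0, \<open>s\<close> lifted under both binders fixes \<open>y\<close>
    and \<open>z\<close> and acts only on \<open>N\<close>. At any other index \<open>up s\<close>
    yields a shifted term, free of index 0, which the substitution of the mu-rule leaves
    alone.\<close>
  have "subst (up s) \<circ> Var(0 := ?K N) = subst (Var(0 := ?K (subst s N))) \<circ> up s"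
    by (rule ext)
      (auto simp: subst_rename rename_subst rename_eq_subst subst_subst comp_def split: nat.split)
  then show ?case
    using red.mu[of "subst (up s) M" "subst s N"] by (simp add: subst_subst)
qed (auto intro: red.intros)

lemma red_rename: "M \<rightarrow>\<^sub>r M' \<Longrightarrow> rename r M \<rightarrow>\<^sub>r rename r M'"
  by (simp add: rename_eq_subst red_subst)

abbreviation reds :: "trm \<Rightarrow> trm \<Rightarrow> bool" (infix "\<rightarrow>\<^sub>r*" 50) where
  "M \<rightarrow>\<^sub>r* N \<equiv> red\<^sup>*\<^sup>* M N"

lemma reds_map:
  assumes "M \<rightarrow>\<^sub>r* M'" and "\<And>M M'. M \<rightarrow>\<^sub>r M' \<Longrightarrow> f M \<rightarrow>\<^sub>r f M'"
  shows "f M \<rightarrow>\<^sub>r* f M'"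
  using assms(1) by induction (auto intro: assms(2) rtranclp.rtrancl_into_rtrancl)

lemma reds_rename: "M \<rightarrow>\<^sub>r* M' \<Longrightarrow> rename r M \<rightarrow>\<^sub>r* rename r M'"
  by (erule reds_map) (rule red_rename)

lemma reds_Lam: "M \<rightarrow>\<^sub>r* M' \<Longrightarrow> Lam M \<rightarrow>\<^sub>r* Lam M'"
  by (erule reds_map) (rule red.Lam)

lemma reds_Mu: "M \<rightarrow>\<^sub>r* M' \<Longrightarrow> Mu M \<rightarrow>\<^sub>r* Mu M'"
  by (erule reds_map) (rule red.Mu)

lemma reds_App: "M \<rightarrow>\<^sub>r* M' \<Longrightarrow> N \<rightarrow>\<^sub>r* N' \<Longrightarrow> App M N \<rightarrow>\<^sub>r* App M' N'"
  by (rule rtranclp_trans[of _ _ "App M' N"])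
    (erule reds_map, erule red.AppL, erule reds_map, erule red.AppR)

lemma reds_up: "(\<And>i. s i \<rightarrow>\<^sub>r* t i) \<Longrightarrow> up s i \<rightarrow>\<^sub>r* up t i"
  by (cases i) (auto intro: reds_rename)

text \<open>A variable may occur several times or not at all, so one step in a substituted term
  becomes any number of steps, possibly none.\<close>

lemma reds_subst: "(\<And>i. s i \<rightarrow>\<^sub>r* t i) \<Longrightarrow> subst s M \<rightarrow>\<^sub>r* subst t M"
proof (induction M arbitrary: s t)
  case (Lam M)
  then have "subst (up s) M \<rightarrow>\<^sub>r* subst (up t) M"
    by (blast intro: reds_up)
  then show ?case by (simp add: reds_Lam)
next
  case (Mu M)
  then have "subst (up s) M \<rightarrow>\<^sub>r* subst (up t) M"
    by (blast intro: reds_up)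
  then show ?case by (simp add: reds_Mu)
qed (auto intro: reds_App)

lemma reds_inst: "K \<rightarrow>\<^sub>r* K' \<Longrightarrow> subst (case_nat K Var) M \<rightarrow>\<^sub>r* subst (case_nat K' Var) M"
  by (rule reds_subst) (simp split: nat.split)

section \<open>Strong normalization\<close>

abbreviation step :: "(trm \<times> trm) set" where
  "step \<equiv> {(M', M). M \<rightarrow>\<^sub>r M'}"

abbreviation SN :: "trm set" where
  "SN \<equiv> Wellfounded.acc step"

lemma SN_strongly_normalizable:
  assumes "M \<in> SN"
  shows "strongly_normalizable M"
  using assms
proof (induction rule: acc.induct)
  case (accI M)
  show ?case
    unfolding strongly_normalizable_def
  proof
    assume "\<exists>S. S 0 = M \<and> (\<forall>n. S n \<rightarrow>\<^sub>r S (Suc n))"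
    then obtain S where S: "S 0 = M" "\<And>n. S n \<rightarrow>\<^sub>r S (Suc n)"
      by blast
    have "strongly_normalizable (S 1)"
      using accI.IH[of "S 1"] S(1) S(2)[of 0] by simp
    moreover have "\<exists>T. T 0 = S 1 \<and> (\<forall>n. T n \<rightarrow>\<^sub>r T (Suc n))"
      by (rule exI[of _ "\<lambda>n. S (Suc n)"]) (simp add: S)
    ultimately show False
      unfolding strongly_normalizable_def by blast
  qed
qed

lemma SN_intro: "(\<And>M'. M \<rightarrow>\<^sub>r M' \<Longrightarrow> M' \<in> SN) \<Longrightarrow> M \<in> SN"
  by (rule acc.accI) simp

lemma SN_red: "M \<in> SN \<Longrightarrow> M \<rightarrow>\<^sub>r M' \<Longrightarrow> M' \<in> SN"
  by (rule acc_downward) auto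

text \<open>The function \<open>f\<close> carries each reduction sequence from \<open>M\<close> to
  one from \<open>f M\<close>, step by step.\<close>

lemma SN_map:
  assumes "f M \<in> SN" and "\<And>M M'. M \<rightarrow>\<^sub>r M' \<Longrightarrow> f M \<rightarrow>\<^sub>r f M'"
  shows "M \<in> SN"
  using assms(1)
proof (induction "f M" arbitrary: M rule: acc.induct)
  case (accI M)
  show ?case by (rule SN_intro) (auto intro: accI.hyps(2) assms(2))
qed

text \<open>Reducing a substituted term can cost several steps at once, so the hypothesis must cover
  every nonempty reduction sequence. The claim is therefore proved for all reducts of
  \<open>M\<close> together.\<close>

lemma SN_induct_tranclp [consumes 1, case_names step]:
  assumes "M \<in> SN"
    and step: "\<And>M. M \<in> SN \<Longrightarrow> (\<And>M'. red\<^sup>+\<^sup>+ M M' \<Longrightarrow> P M') \<Longrightarrow> P M"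
  shows "P M"
proof -
  have "\<forall>M'. M \<rightarrow>\<^sub>r* M' \<longrightarrow> P M'"
    using assms(1)
  proof (induction rule: acc.induct)
    case (accI M)
    have *: "P M'" if trans: "red\<^sup>+\<^sup>+ M M'" for M'
    proof -
      obtain M1 where "M \<rightarrow>\<^sub>r M1" "M1 \<rightarrow>\<^sub>r* M'"
        using tranclpD[OF trans] by blast
      then show ?thesis using accI.IH by blast
    qed
    have "M \<in> SN" using accI.hyps by (rule acc.accI)
    then have "P M" using * by (rule step)
    then show ?case using * by (auto dest: rtranclpD)
  qed
  then show ?thesis by blast
qed

section \<open>Stacks of arguments\<close>

abbreviation apps :: "trm \<Rightarrow> trm list \<Rightarrow> trm" where
  "apps \<equiv> foldl App"

lemma red_apps_head: "M \<rightarrow>\<^sub>r M' \<Longrightarrow> apps M Ns \<rightarrow>\<^sub>r apps M' Ns"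
  by (induction Ns arbitrary: M M') (auto intro: red.AppL)

lemma red_apps_args:
  "(Ns', Ns) \<in> listrel1 step \<Longrightarrow> apps M Ns \<rightarrow>\<^sub>r apps M Ns'"
  by (induction Ns arbitrary: M Ns') (auto intro!: red_apps_head red.AppR)

lemma red_apps_cases [consumes 1, case_names head args beta mu]:
  assumes "apps M Ns \<rightarrow>\<^sub>r L"
  obtains (head) M' where "M \<rightarrow>\<^sub>r M'" "L = apps M' Ns"
  | (args) Ns' where "(Ns', Ns) \<in> listrel1 step" "L = apps M Ns'"
  | (beta) P N Ns' where "M = Lam P" "Ns = N # Ns'" "L = apps (subst (case_nat N Var) P) Ns'"
  | (mu) P N Ns' where "M = Mu P" "Ns = N # Ns'"
      "L = apps (Mu (subst (Var(0 := Lam (App (Var 1) (App (Var 0) (shift (shift N)))))) P)) Ns'"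
proof -
  have "(\<exists>M'. M \<rightarrow>\<^sub>r M' \<and> L = apps M' Ns)
    \<or> (\<exists>Ns'. (Ns', Ns) \<in> listrel1 step \<and> L = apps M Ns')
    \<or> (\<exists>P N Ns'. M = Lam P \<and> Ns = N # Ns' \<and> L = apps (subst (case_nat N Var) P) Ns')
    \<or> (\<exists>P N Ns'. M = Mu P \<and> Ns = N # Ns' \<and>
      L = apps (Mu (subst (Var(0 := Lam (App (Var 1) (App (Var 0) (shift (shift N)))))) P)) Ns')"
    using assms
  proof (induction Ns arbitrary: M)
    case Nil
    then show ?case by simp
  next
    case (Cons N Ns)
    then have "apps (App M N) Ns \<rightarrow>\<^sub>r L" by simp
    \<comment> \<open>The head is now an application, neither \<open>Lam\<close> nor
      \<open>Mu\<close>, so the last two alternatives are void.\<close>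
    from Cons.IH[OF this] consider
      (hd) M' where "App M N \<rightarrow>\<^sub>r M'" "L = apps M' Ns"
      | (tl) Ns' where "(Ns', Ns) \<in> listrel1 step" "L = apps (App M N) Ns'"
      by (elim disjE exE conjE) (blast, blast, simp, simp)
    then show ?case
    proof cases
      case hd
      from hd(1) show ?thesis
      proof cases
        case (beta P)
        then show ?thesis using hd(2) by blast
      next
        case (mu P)
        then show ?thesis using hd(2) by blast
      next
        case (AppL P)
        then show ?thesis using hd(2) by auto
      next
        case (AppR N')
        then have "(N' # Ns, N # Ns) \<in> listrel1 step" by simp
        then show ?thesis using AppR hd(2) by (metis foldl_Cons)
      qed
    next
      case tl
      then have "(N # Ns', N # Ns) \<in> listrel1 step" by simp
      then show ?thesis using tl(2) by (metis foldl_Cons)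
    qed
  qed
  then show thesis
    by (elim disjE exE conjE) (erule (1) head, erule (1) args, erule (2) beta, erule (2) mu)
qed

lemma SN_listrel1: "(Ns', Ns) \<in> listrel1 step \<Longrightarrow> set Ns \<subseteq> SN \<Longrightarrow> set Ns' \<subseteq> SN"
  by (auto simp: listrel1_def intro: SN_red)

lemma SN_args_acc: "set Ns \<subseteq> SN \<Longrightarrow> Ns \<in> Wellfounded.acc (listrel1 step)"
proof (induction Ns)
  case Nil
  show ?case by (rule acc.accI) simp
qed auto

lemma SN_apps_Var:
  assumes "set Ns \<subseteq> SN"
  shows "apps (Var x) Ns \<in> SN"
  using SN_args_acc[OF assms]
proof (induction rule: acc.induct)
  case (accI Ns)
  show ?case
  proof (rule SN_intro)
    fix L assume "apps (Var x) Ns \<rightarrow>\<^sub>r L"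
    then show "L \<in> SN"
    proof (cases rule: red_apps_cases)
      case (head M')
      then show ?thesis by (auto elim: red.cases)
    qed (use accI.IH in auto)
  qed
qed

lemma SN_apps_head: "apps M Ns \<in> SN \<Longrightarrow> M \<in> SN"
  by (erule SN_map) (rule red_apps_head)

lemma reds_apps_head: "M \<rightarrow>\<^sub>r* M' \<Longrightarrow> apps M Ns \<rightarrow>\<^sub>r* apps M' Ns"
  by (erule reds_map) (rule red_apps_head)

text \<open>Outer induction on the contractum \<open>W\<close>, inner induction on \<open>N\<close>.
  Steps in \<open>M\<close> or \<open>Ns\<close> reduce \<open>W\<close>; a step in \<open>N\<close>
  either reduces \<open>W\<close> or leaves it unchanged, as when the bound variable does not occur
  in \<open>M\<close>, and then the inner induction applies.\<close>

lemma SN_beta_expansion: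
  assumes "apps (subst (case_nat N Var) M) Ns \<in> SN" and "N \<in> SN"
  shows "apps (App (Lam M) N) Ns \<in> SN"
  using assms
proof (induction (no_simp) W \<equiv> "apps (subst (case_nat N Var) M) Ns" arbitrary: M N Ns
    rule: SN_induct_tranclp)
  case (step W M N Ns)
  note outer = step.IH
  from step.prems show ?case
  proof (induction rule: acc.induct)
    case (accI N)
    have N: "N \<in> SN" using accI.hyps by (rule acc.accI)
    show ?case
    proof (rule SN_intro)
      fix L assume "apps (App (Lam M) N) Ns \<rightarrow>\<^sub>r L"
      then show "L \<in> SN"
      proof (cases rule: red_apps_cases)
        case (head M')
        from head(1) show ?thesis
        proof cases
          case beta
          then show ?thesis using accI.prems step.hyps head(2) by simp
        next
          case (AppL Q)
          from AppL(2) obtain M1 where M1: "Q = Lam M1" "M \<rightarrow>\<^sub>r M1"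
            by (auto elim: red.cases)
          then have "red\<^sup>+\<^sup>+ W (apps (subst (case_nat N Var) M1) Ns)"
            unfolding accI.prems by (intro tranclp.r_into_trancl red_apps_head red_subst)
          from outer[OF this N refl] show ?thesis
            using head(2) AppL(1) M1(1) by simp
        next
          case (AppR N')
          have r: "W \<rightarrow>\<^sub>r* apps (subst (case_nat N' Var) M) Ns"
            unfolding accI.prems using AppR(2)
            by (intro reds_apps_head reds_inst r_into_rtranclp)
          have "apps (App (Lam M) N') Ns \<in> SN"
          proof (cases "W = apps (subst (case_nat N' Var) M) Ns")
            case True
            then show ?thesis using accI.IH[of N'] accI.prems AppR(2) by simp
          next
            case False
            then have "red\<^sup>+\<^sup>+ W (apps (subst (case_nat N' Var) M) Ns)"
              using r by (auto dest: rtranclpD)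
            from outer[OF this SN_red[OF N AppR(2)] refl] show ?thesis .
          qed
          then show ?thesis using head(2) AppR(1) by simp
        qed
      next
        case (args Ns')
        then have "red\<^sup>+\<^sup>+ W (apps (subst (case_nat N Var) M) Ns')"
          unfolding accI.prems by (intro tranclp.r_into_trancl red_apps_args)
        from outer[OF this N refl] show ?thesis using args(2) by simp
      qed auto
    qed
  qed
qed

text \<open>The base variable is an arbitrary one and may be captured from the ambient context: only the
  strong normalization of instances matters, and this choice spares a closure of reducibility under
  renaming.\<close>

primrec kont :: "trm list \<Rightarrow> trm" where
  "kont [] = Var 0"
| "kont (N # Ns) = Lam (App (shift (kont Ns)) (App (Var 0) (shift N)))"

lemma reds_kont: "(Ns', Ns) \<in> listrel1 step \<Longrightarrow> kont Ns \<rightarrow>\<^sub>r* kont Ns'"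
proof (induction Ns arbitrary: Ns')
  case (Cons N Ns)
  then show ?case
    by (auto intro!: reds_Lam reds_App reds_rename)
qed simp

text \<open>Giving \<open>y\<close> the continuation of the remaining stack rebuilds the
  continuation of the full one. Instantiating \<open>y\<close> removes one of the two shifts of
  \<open>N\<close>; the one for \<open>z\<close> remains.\<close>

lemma subst_kont_mu:
  "subst (case_nat (kont Ns) Var)
    (subst (Var(0 := Lam (App (Var 1) (App (Var 0) (shift (shift N)))))) M)
   = subst (case_nat (kont (N # Ns)) Var) M"
proof -
  have "subst (case_nat (kont Ns) Var) \<circ> Var(0 := Lam (App (Var 1) (App (Var 0) (shift (shift N)))))
    = case_nat (kont (N # Ns)) Var"
    by (intro ext)
      (auto simp: subst_rename comp_def split: nat.split, simp add: rename_eq_subst comp_def)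
  then show ?thesis by (simp add: subst_subst)
qed

text \<open>Lexicographic induction on \<open>W\<close>, the length of \<open>Ns\<close>, and the
  reductions inside \<open>Ns\<close>. A step in \<open>M\<close> reduces \<open>W\<close>; a step
  in an argument reduces \<open>W\<close> or keeps both \<open>W\<close> and the length; a mu-step
  keeps \<open>W\<close> and shortens the stack.\<close>

lemma SN_apps_Mu:
  assumes "subst (case_nat (kont Ns) Var) M \<in> SN" and "set Ns \<subseteq> SN"
  shows "apps (Mu M) Ns \<in> SN"
  using assms
proof (induction (no_simp) W \<equiv> "subst (case_nat (kont Ns) Var) M" arbitrary: M Ns rule: SN_induct_tranclp)
  case (step W M Ns)
  note outer = step.IH
  from step.prems show ?case
  proof (induction "length Ns" arbitrary: M Ns rule: less_induct)
    case less
    note shorter = less.hyps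
    \<comment> \<open>The hypothesis on shorter stacks is carried along; it survives the innermost
      induction because reducing an argument preserves the length.\<close>
    from SN_args_acc[OF less.prems(1)] less.prems shorter show ?case
    proof (induction Ns rule: acc.induct)
      case (accI Ns)
      show ?case
      proof (rule SN_intro)
        fix L assume "apps (Mu M) Ns \<rightarrow>\<^sub>r L"
        then show "L \<in> SN"
        proof (cases rule: red_apps_cases)
          case (head Q)
          from head(1) obtain M1 where M1: "Q = Mu M1" "M \<rightarrow>\<^sub>r M1"
            by (auto elim: red.cases)
          then have "red\<^sup>+\<^sup>+ W (subst (case_nat (kont Ns) Var) M1)"
            unfolding accI.prems(2) by (intro tranclp.r_into_trancl red_subst)
          from outer[OF this accI.prems(1) refl] show ?thesis using head(2) M1(1) by simp
        next
          case (args Ns')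
          have Ns': "set Ns' \<subseteq> SN"
            using args(1) accI.prems(1) by (rule SN_listrel1)
          have r: "W \<rightarrow>\<^sub>r* subst (case_nat (kont Ns') Var) M"
            unfolding accI.prems(2) using args(1) by (intro reds_inst reds_kont)
          show ?thesis
          proof (cases "W = subst (case_nat (kont Ns') Var) M")
            case True
            have "length Ns' = length Ns" using args(1) by (rule listrel1_eq_len)
            then show ?thesis
              using accI.IH[OF args(1) Ns' True] accI.prems(3) args(2) by simp
          next
            case False
            then have "red\<^sup>+\<^sup>+ W (subst (case_nat (kont Ns') Var) M)"
              using r by (auto dest: rtranclpD)
            from outer[OF this Ns' refl] show ?thesis using args(2) by simp
          qed
        next
          case (mu P N Ns')
          let ?M' = "subst (Var(0 := Lam (App (Var 1) (App (Var 0) (shift (shift N)))))) M"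
          have "W = subst (case_nat (kont Ns') Var) ?M'"
            unfolding accI.prems(2) mu(2) by (rule subst_kont_mu[symmetric])
          then have "apps (Mu ?M') Ns' \<in> SN"
            using accI.prems(1) mu(2) by (intro accI.prems(3)) auto
          then show ?thesis using mu by simp
        qed simp
      qed
    qed
  qed
qed

section \<open>Reducibility\<close>

text \<open>The condition on \<open>N\<close> is reducibility at \<open>A\<close>, unfolded so that
  a single structural recursion on types suffices.\<close>

primrec stacks :: "'a ty \<Rightarrow> trm list set" where
  "stacks (Atom a) = {[]}"
| "stacks Bot = {[]}"
| "stacks (A \<rightarrow>\<^sub>t B) = {N # Ns | N Ns. (\<forall>Ps\<in>stacks A. apps N Ps \<in> SN) \<and> Ns \<in> stacks B}"

definition reducible :: "'a ty \<Rightarrow> trm set" where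
  "reducible A = {M. \<forall>Ns\<in>stacks A. apps M Ns \<in> SN}"

lemma stacks_Arrow: "stacks (A \<rightarrow>\<^sub>t B) = {N # Ns | N Ns. N \<in> reducible A \<and> Ns \<in> stacks B}"
  by (simp add: reducible_def)

text \<open>The two claims need each other: strongly normalizing stacks make variables reducible,
  which supplies an argument for a stack of arrow type; nonemptiness gives a stack to apply a
  reducible term to, so that the term itself is strongly normalizing.\<close>

lemma stacks_SN: "stacks A \<noteq> {} \<and> (\<forall>Ns\<in>stacks A. set Ns \<subseteq> SN)"
proof (induction A)
  case (Arrow A B)
  then have "Var 0 \<in> reducible A"
    by (auto simp: reducible_def intro: SN_apps_Var)
  moreover have "reducible A \<subseteq> SN"
    using Arrow by (auto simp: reducible_def intro: SN_apps_head)
  ultimately show ?case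
    using Arrow unfolding stacks_Arrow by (auto 0 3)
qed simp_all

lemma reducible_SN: "M \<in> reducible A \<Longrightarrow> M \<in> SN"
  using stacks_SN[of A] by (auto simp: reducible_def intro: SN_apps_head)

lemma reducible_Var: "Var x \<in> reducible A"
  using stacks_SN[of A] by (auto simp: reducible_def intro: SN_apps_Var)

lemma reducible_App: "M \<in> reducible (A \<rightarrow>\<^sub>t B) \<Longrightarrow> N \<in> reducible A \<Longrightarrow> App M N \<in> reducible B"
  by (fastforce simp: reducible_def)

lemma reducible_Bot: "reducible (Bot :: 'a ty) = SN"
  by (simp add: reducible_def)

lemma reducible_Lam:
  assumes "\<And>N. N \<in> reducible A \<Longrightarrow> subst (case_nat N Var) M \<in> reducible B"
  shows "Lam M \<in> reducible (A \<rightarrow>\<^sub>t B)"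
proof -
  have "apps (App (Lam M) N) Ns \<in> SN" if "N \<in> reducible A" "Ns \<in> stacks B" for N Ns
    using that assms[of N] reducible_SN[of N]
    by (intro SN_beta_expansion) (auto simp: reducible_def)
  then show ?thesis
    by (auto simp: reducible_def[of "A \<rightarrow>\<^sub>t B"] stacks_Arrow simp del: stacks.simps)
qed

text \<open>Applied to \<open>Q\<close>, the continuation of \<open>N # Ns'\<close> contracts to
  that of \<open>Ns'\<close> applied to \<open>App Q N\<close>, a reducible term of the smaller type
  \<open>B\<close>. The base case is a variable.\<close>

lemma reducible_kont:
  fixes A :: "'a ty"
  shows "Ns \<in> stacks A \<Longrightarrow> kont Ns \<in> reducible (Neg A)"
proof (induction A arbitrary: Ns)
  case (Arrow A B)
  then obtain N Ns' where Ns: "Ns = N # Ns'" "N \<in> reducible A" "Ns' \<in> stacks B"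
    by (auto simp: stacks_Arrow simp del: stacks.simps)
  have "Lam (App (shift (kont Ns')) (App (Var 0) (shift N))) \<in> reducible (Neg (A \<rightarrow>\<^sub>t B))"
  proof (rule reducible_Lam)
    fix Q assume "Q \<in> reducible (A \<rightarrow>\<^sub>t B)"
    then have "App (kont Ns') (App Q N) \<in> reducible (Bot :: 'a ty)"
      using Ns Arrow.IH(2) by (blast intro: reducible_App)
    then show "subst (case_nat Q Var) (App (shift (kont Ns')) (App (Var 0) (shift N))) \<in> reducible (Bot :: 'a ty)"
      by (simp add: subst_rename comp_def subst_Var)
  qed
  then show ?case using Ns by simp
qed (auto intro: reducible_Var)

text \<open>For each stack \<open>Ns\<close> the single instance \<open>K = kont Ns\<close> is
  enough.\<close>

lemma reducible_Mu:
  assumes "\<And>K. K \<in> reducible (Neg A) \<Longrightarrow> subst (case_nat K Var) M \<in> SN"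
  shows "Mu M \<in> reducible A"
  unfolding reducible_def
  using assms reducible_kont stacks_SN by (blast intro: SN_apps_Mu)

text \<open>Soundness of typing for reducibility. The substitution \<open>s\<close> is arbitrary so
  that at a binder it can be extended by any reducible term.\<close>

lemma typing_reducible:
  fixes A :: "'a ty"
  assumes "G \<turnstile> M : A" and "\<And>i B. G i = Some B \<Longrightarrow> s i \<in> reducible B"
  shows "subst s M \<in> reducible A"
  using assms
proof (induction arbitrary: s rule: typing.induct)
  case (ax G x A)
  then show ?case by simp
next
  case (arrow_i A G M B)
  have "subst (case_nat N s) M \<in> reducible B" if "N \<in> reducible A" for N
    by (rule arrow_i.IH) (use that arrow_i.prems in \<open>auto split: nat.splits\<close>)
  then show ?case by (auto simp: subst_inst_up intro: reducible_Lam)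
next
  case (arrow_e G1 M A B G2 N)
  \<comment> \<open>Since \<open>++\<close> prefers \<open>G2\<close>, compatibility is what
    preserves the declarations of \<open>G1\<close>.\<close>
  have "(G1 ++ G2) i = Some C" if "G1 i = Some C" for i C
    using that arrow_e.hyps(3) by (force simp: compatible_def map_add_def split: option.split)
  then show ?case
    using arrow_e by (auto intro!: reducible_App[of _ A B])
next
  case (bot_c A G M)
  have "subst (case_nat K s) M \<in> reducible (Bot :: 'a ty)" if "K \<in> reducible (Neg A)" for K
    by (rule bot_c.IH) (use that bot_c.prems in \<open>auto split: nat.splits\<close>)
  then show ?case by (auto simp: subst_inst_up reducible_Bot intro: reducible_Mu)
qed

theorem theorem3p1:
  fixes G :: "'a ctx" and M :: trm and A :: "'a ty"
  assumes "G \<turnstile> M : A"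
  shows "strongly_normalizable M"
proof -
  have "subst Var M \<in> reducible A"
    using assms by (rule typing_reducible) (rule reducible_Var)
  then show ?thesis
    by (simp add: subst_Var reducible_SN SN_strongly_normalizable)
qed

end
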